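(* Let $G$ be a finite simple graph. Then $\mathrm{v}_{\emptyset}(J_{G})=\mathrm{min\mbox{-}comp}(G)$. In particular, $\mathrm{v}(J_{G})\leq \mathrm{min\mbox{-}comp}(G)$.
   Context: Let $K$ be a field and $G$ a finite simple graph on $V(G)=[n]=\{1,\dots,n\}$. Put $S=K[x_1,\dots,x_n,y_1,\dots,y_n]$ (standard grading) and $f_{ij}=x_iy_j-x_jy_i$. The binomial edge ideal of $G$ is $J_G=\langle f_{ij}\mid \{i,j\}\in E(G),\ i<j\rangle\subseteq S$. For a proper graded ideal $I$ of a standard graded polynomial ring $R=\bigoplus_{d\ge 0} R_d$ and $\mathfrak p\in\mathrm{Ass}(I)$ (associated primes of $R/I$), let $\mathrm{v}_{\mathfrak p}(I)=\min\{d\ge 0\mid \exists f\in R_d \text{ with } (I:f)=\mathfrak p\}$ and $\mathrm{v}(I)=\min\{\mathrm{v}_{\mathfrak p}(I)\mid \mathfrak p\in \mathrm{Ass}(I)\}$. $P_\emptyset(G)$ is the ideal of $S$ generated by all $f_{ij}$ with $i<j$ such that $i,j$ lie in the same connected component of $G$; it is a (minimal) associated prime of $J_G$. Write $\mathrm{v}_\emptyset(J_G)=\mathrm{v}_{P_\emptyset(G)}(J_G)$. For $v\in V(G)$, let $\mathcal N_G(v)$ be its set of neighbours and let $G_v$ be the graph with $V(G_v)=V(G)$ and $E(G_v)=E(G)\cup\{\{i,j\}\mid i,j\in \mathcal N_G(v), i\ne j\}$. For $V=\{v_1,\dots,v_k\}\subseteq V(G)$, let $G_V=(\cdots((G_{v_1})_{v_2})\cdots)_{v_k}$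 (this is independent of the ordering; $G_\emptyset=G$). A set $W\subseteq V(G)$ is a completion set of $G$ if $G_W$ is a disjoint union of complete graphs; it is a minimal completion set if moreover no proper subset $U\subsetneq W$ is a completion set. $\mathrm{min\mbox{-}comp}(G)$ is the minimum cardinality of a minimal completion set of $G$. *)

theory Defs
  imports
    "HOL-Algebra.Ideal"
    "HOL-Library.Poly_Mapping"
    "HOL-Library.Disjoint_Sets"
    "HOL-Library.Extended_Nat"
begin

section \<open>The v-number of a graded ideal\<close>

definition colon :: "('a, 'b) ring_scheme \<Rightarrow> 'a set \<Rightarrow> 'a \<Rightarrow> 'a set" where
  "colon R I f = {g \<in> carrier R. g \<otimes>\<^bsub>R\<^esub> f \<in> I}"

text \<open>The annihilator of the class of \<open>f\<close> in the module \<open>R/I\<close> is \<open>(I : f)\<close>, so these are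
  the associated primes of \<open>R/I\<close>.\<close>

definition associated_primes :: "('a, 'b) ring_scheme \<Rightarrow> 'a set \<Rightarrow> 'a set set" where
  "associated_primes R I = {P. primeideal P R \<and> (\<exists>f\<in>carrier R. colon R I f = P)}"

text \<open>The grading is given by its homogeneous components \<open>A d\<close>. The minimum is taken in
  \<^typ>\<open>enat\<close>, so that it would be \<open>\<infinity>\<close>, and not an unspecified number, over an empty set.\<close>

definition v_number_at ::
    "('a, 'b) ring_scheme \<Rightarrow> (nat \<Rightarrow> 'a set) \<Rightarrow> 'a set \<Rightarrow> 'a set \<Rightarrow> enat" where
  "v_number_at R A I P = Inf {enat d |d. \<exists>f\<in>A d. colon R I f = P}"

definition v_number :: "('a, 'b) ring_scheme \<Rightarrow> (nat \<Rightarrow> 'a set) \<Rightarrow> 'a set \<Rightarrow> enat" where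
  "v_number R A I = Inf (v_number_at R A I ` associated_primes R I)"


section \<open>The polynomial ring in $x_1,\dots,x_n,y_1,\dots,y_n$\<close>

datatype indet = X nat | Y nat

type_synonym monom = "indet \<Rightarrow>\<^sub>0 nat"

text \<open>A polynomial maps each monomial (exponent vector) to its coefficient.\<close>

type_synonym 'k mpoly = "monom \<Rightarrow>\<^sub>0 'k"

definition indets :: "nat \<Rightarrow> indet set" where
  "indets n = X ` {1..n} \<union> Y ` {1..n}"

definition poly_ring :: "nat \<Rightarrow> 'k::field mpoly ring" where
  "poly_ring n =
    \<lparr>carrier = {p. \<forall>m\<in>Poly_Mapping.keys p. Poly_Mapping.keys m \<subseteq> indets n},
     mult = (*), one = 1, zero = 0, add = (+)\<rparr>"

definition monom_degree :: "monom \<Rightarrow> nat" where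
  "monom_degree m = (\<Sum>z\<in>Poly_Mapping.keys m. Poly_Mapping.lookup m z)"

definition homogeneous_part :: "nat \<Rightarrow> nat \<Rightarrow> 'k::field mpoly set" where
  "homogeneous_part n d =
    {p \<in> carrier (poly_ring n). \<forall>m\<in>Poly_Mapping.keys p. monom_degree m = d}"

definition indet_poly :: "indet \<Rightarrow> 'k::field mpoly" where
  "indet_poly z = Poly_Mapping.single (Poly_Mapping.single z 1) 1"

definition edge_binomial :: "nat \<Rightarrow> nat \<Rightarrow> 'k::field mpoly" where
  "edge_binomial i j =
    indet_poly (X i) * indet_poly (Y j) - indet_poly (X j) * indet_poly (Y i)"


section \<open>Graphs and completion sets\<close>

text \<open>A graph on \<open>{1..n}\<close> is represented by \<open>n\<close> and its set \<open>E\<close> of edges.\<close>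

definition simple_graph :: "nat \<Rightarrow> nat set set \<Rightarrow> bool" where
  "simple_graph n E \<longleftrightarrow> (\<forall>e\<in>E. e \<subseteq> {1..n} \<and> card e = 2)"

definition neighbours :: "nat set set \<Rightarrow> nat \<Rightarrow> nat set" where
  "neighbours E v = {w. {v, w} \<in> E}"

definition same_component :: "nat set set \<Rightarrow> nat \<Rightarrow> nat \<Rightarrow> bool" where
  "same_component E i j \<longleftrightarrow> (i, j) \<in> {(a, b). {a, b} \<in> E}\<^sup>*"

definition complete_at :: "nat \<Rightarrow> nat set set \<Rightarrow> nat set set" where
  "complete_at v E =
    E \<union> {{i, j} |i j. i \<in> neighbours E v \<and> j \<in> neighbours E v \<and> i \<noteq> j}"

text \<open>The graph obtained by completing successively at the vertices of a finite set does not
  depend on their order; we take them in increasing order.\<close>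

definition complete_along :: "nat set \<Rightarrow> nat set set \<Rightarrow> nat set set" where
  "complete_along W E = fold complete_at (sorted_list_of_set W) E"

definition disjoint_union_of_complete :: "nat \<Rightarrow> nat set set \<Rightarrow> bool" where
  "disjoint_union_of_complete n E \<longleftrightarrow>
    (\<exists>\<P>. partition_on {1..n} \<P> \<and> E = (\<Union>B\<in>\<P>. {e. e \<subseteq> B \<and> card e = 2}))"

definition completion_set :: "nat \<Rightarrow> nat set set \<Rightarrow> nat set \<Rightarrow> bool" where
  "completion_set n E W \<longleftrightarrow>
    W \<subseteq> {1..n} \<and> disjoint_union_of_complete n (complete_along W E)"

definition minimal_completion_set :: "nat \<Rightarrow> nat set set \<Rightarrow> nat set \<Rightarrow> bool" where
  "minimal_completion_set n E W \<longleftrightarrow>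
    completion_set n E W \<and> (\<forall>U. U \<subset> W \<longrightarrow> \<not> completion_set n E U)"

definition min_comp :: "nat \<Rightarrow> nat set set \<Rightarrow> nat" where
  "min_comp n E = Min {card W |W. minimal_completion_set n E W}"


section \<open>Binomial edge ideals\<close>

definition binomial_edge_ideal :: "nat \<Rightarrow> nat set set \<Rightarrow> 'k::field mpoly set" where
  "binomial_edge_ideal n E =
    Idl\<^bsub>poly_ring n\<^esub> {edge_binomial i j |i j. {i, j} \<in> E \<and> i < j}"

definition P_empty :: "nat \<Rightarrow> nat set set \<Rightarrow> 'k::field mpoly set" where
  "P_empty n E =
    Idl\<^bsub>poly_ring n\<^esub>
      {edge_binomial i j |i j. i \<in> {1..n} \<and> j \<in> {1..n} \<and> i < j \<and> same_component E i j}"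

text \<open>The argument of type \<^typ>\<open>'k itself\<close> names the coefficient field.\<close>

definition v_binomial_edge_ideal :: "'k::field itself \<Rightarrow> nat \<Rightarrow> nat set set \<Rightarrow> enat" where
  "v_binomial_edge_ideal K n E =
    v_number (poly_ring n) (homogeneous_part n) (binomial_edge_ideal n E :: 'k mpoly set)"

definition v_empty :: "'k::field itself \<Rightarrow> nat \<Rightarrow> nat set set \<Rightarrow> enat" where
  "v_empty K n E =
    v_number_at (poly_ring n) (homogeneous_part n)
      (binomial_edge_ideal n E :: 'k mpoly set) (P_empty n E)"

end

theory Submission imports Defs begin

text \<open>
  Write \<open>J\<close> for the binomial edge ideal and \<open>P\<close> for \<open>P_empty n E\<close>.

  The ideal \<open>P\<close> is toric: it is the kernel of the map \<open>x\<^sub>i \<mapsto> s\<^sub>i a\<^sub>c\<close>, \<open>y\<^sub>i \<mapsto> s\<^sub>i\<close>, where \<open>c\<close> is the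
  component of \<open>i\<close> (\<open>P_empty_eq_kernel\<close>). This makes \<open>P\<close> prime and tests membership in it by
  comparing coefficients: the coefficients of all monomials with the same image must add up to \<open>0\<close>.

  For \<open>\<le>\<close>, the identity \<open>x\<^sub>v f\<^sub>i\<^sub>j = x\<^sub>i f\<^sub>v\<^sub>j - x\<^sub>j f\<^sub>v\<^sub>i\<close> shows that multiplication by \<open>x\<^sub>v\<close> carries
  the binomials of the graph completed at \<open>v\<close> into \<open>J\<close>. Hence, for a completion set \<open>W\<close>, the product
  \<open>f\<close> of the \<open>x\<^sub>v\<close> with \<open>v \<in> W\<close> carries all of \<open>P\<close> into \<open>J\<close>. Since \<open>J \<subseteq> P\<close>, \<open>P\<close> is prime and no
  monomial lies in \<open>P\<close>, it follows that \<open>(J : f) = P\<close>, with \<open>f\<close> of degree \<open>card W\<close>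
  (\<open>colon_vertex_product\<close>).

  For \<open>\<ge>\<close>, let \<open>f\<close> be homogeneous of degree \<open>d\<close> with \<open>(J : f) = P\<close>. Then \<open>f \<notin> P\<close>, so some weight of
  the toric map has a nonzero coefficient sum in \<open>f\<close>. The weight fixes the degree of each monomial
  in the pair \<open>x\<^sub>i, y\<^sub>i\<close>, for each \<open>i\<close>; let \<open>W\<close> be the set of those \<open>i\<close> for which it is positive, so
  \<open>card W \<le> d\<close>. If \<open>W\<close> were not a completion set, there would be vertices \<open>i, j\<close> of one component that
  no path through \<open>W\<close> connects. Setting all variables outside \<open>U = W \<union> {i, j}\<close> to \<open>0\<close> takes
  \<open>f f\<^sub>i\<^sub>j \<in> J\<close> to an element of the prime ideal of the components of the graph induced on \<open>U\<close>. This ideal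
  does not contain \<open>f\<^sub>i\<^sub>j\<close>, so it contains the restriction of \<open>f\<close>, and it lies in \<open>P\<close>. But the chosen
  coefficient sum survives the restriction, a contradiction (\<open>completion_set_from_colon\<close>).
\<close>

abbreviation "keys \<equiv> Poly_Mapping.keys"
abbreviation "lookup \<equiv> Poly_Mapping.lookup"
abbreviation "single \<equiv> Poly_Mapping.single"

section \<open>Linear maps induced by maps of monomials\<close>

text \<open>The monomials outside \<open>M\<close> are sent to \<open>0\<close> and the others are relabelled by \<open>w\<close>. For a monomial ring
  this covers both a monomial substitution (\<open>M\<close> everything) and setting some variables to \<open>0\<close>
  (\<open>w\<close> the identity).\<close>

definition pushforward :: "('m \<Rightarrow> 'n) \<Rightarrow> 'm set \<Rightarrow> ('m \<Rightarrow>\<^sub>0 'k::comm_monoid_add) \<Rightarrow> ('n \<Rightarrow>\<^sub>0 'k)" where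
  "pushforward w M p = (\<Sum>m\<in>keys p \<inter> M. single (w m) (lookup p m))"

lemma sum_single_lookup: "(\<Sum>m\<in>keys p. single m (lookup p m)) = p"
  by (rule poly_mapping_eqI) (auto simp: lookup_sum lookup_single when_def not_in_keys_iff_lookup_eq_zero)

lemma pushforward_superset:
  assumes "finite A" "keys p \<subseteq> A"
  shows "pushforward w M p = (\<Sum>m\<in>A \<inter> M. single (w m) (lookup p m))"
  unfolding pushforward_def
  by (rule sum.mono_neutral_left) (use assms in \<open>auto simp: in_keys_iff\<close>)

lemma pushforward_zero [simp]: "pushforward w M 0 = 0"
  by (simp add: pushforward_def)

lemma pushforward_single:
  "pushforward w M (single m c) = (if m \<in> M then single (w m) c else 0)"
  by (subst pushforward_superset[where A = "{m}"]) auto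

lemma pushforward_add: "pushforward w M (p + q) = pushforward w M p + pushforward w M q"
proof -
  let ?A = "keys p \<union> keys q"
  have "pushforward w M r = (\<Sum>m\<in>?A \<inter> M. single (w m) (lookup r m))" if "keys r \<subseteq> ?A" for r
    using that by (intro pushforward_superset) auto
  from this[of p] this[of q] this[of "p + q"] show ?thesis
    using keys_add[of p q] by (simp add: lookup_add single_add sum.distrib)
qed

lemma pushforward_sum: "pushforward w M (sum p A) = (\<Sum>a\<in>A. pushforward w M (p a))"
  by (induction A rule: infinite_finite_induct) (auto simp: pushforward_add)

lemma pushforward_diff:
  fixes p q :: "'m \<Rightarrow>\<^sub>0 'k::ab_group_add"
  shows "pushforward w M (p - q) = pushforward w M p - pushforward w M q"
  using pushforward_add[of w M "p - q" q] by simp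

lemma lookup_pushforward:
  "lookup (pushforward w M p) t = (\<Sum>m | m \<in> keys p \<inter> M \<and> w m = t. lookup p m)"
  unfolding pushforward_def lookup_sum lookup_single when_def
  by (rule sum.inter_filter[symmetric]) simp

lemma pushforward_pushforward:
  "pushforward h N (pushforward w M p) = pushforward (h \<circ> w) (M \<inter> w -` N) p"
proof -
  have "pushforward h N (pushforward w M p)
      = (\<Sum>m\<in>keys p \<inter> M. if w m \<in> N then single (h (w m)) (lookup p m) else 0)"
    by (simp add: pushforward_def[of w] pushforward_sum pushforward_single)
  also have "\<dots> = pushforward (h \<circ> w) (M \<inter> w -` N) p"
    by (simp add: pushforward_def sum.If_cases Int_assoc vimage_def)
  finally show ?thesis .
qed

text \<open>The second hypothesis says that the monomials outside \<open>M\<close> span an ideal and that \<open>M\<close> is closed under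
  products, which is what makes sending those outside to \<open>0\<close> multiplicative.\<close>

lemma pushforward_mult:
  fixes p q :: "'m::comm_monoid_add \<Rightarrow>\<^sub>0 'k::comm_ring_1" and w :: "'m \<Rightarrow> 'n::comm_monoid_add"
  assumes w: "\<And>a b. w (a + b) = w a + w b"
    and M: "\<And>a b. a + b \<in> M \<longleftrightarrow> a \<in> M \<and> b \<in> M"
  shows "pushforward w M (p * q) = pushforward w M p * pushforward w M q"
proof -
  have "p * q = (\<Sum>a\<in>keys p. single a (lookup p a)) * (\<Sum>b\<in>keys q. single b (lookup q b))"
    by (simp add: sum_single_lookup)
  also have "\<dots> = (\<Sum>a\<in>keys p. \<Sum>b\<in>keys q. single (a + b) (lookup p a * lookup q b))"
    by (simp add: sum_product mult_single)
  finally have "pushforward w M (p * q)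
      = (\<Sum>a\<in>keys p. \<Sum>b\<in>keys q. pushforward w M (single a (lookup p a)) * pushforward w M (single b (lookup q b)))"
    by (auto simp: pushforward_sum pushforward_single M w mult_single intro!: sum.cong)
  also have "\<dots> = pushforward w M (\<Sum>a\<in>keys p. single a (lookup p a)) * pushforward w M (\<Sum>b\<in>keys q. single b (lookup q b))"
    by (simp add: pushforward_sum sum_product)
  finally show ?thesis by (simp add: sum_single_lookup)
qed


section \<open>The polynomial ring and its ideals\<close>

definition monomials_on :: "nat set \<Rightarrow> monom set" where
  "monomials_on U = {m. keys m \<subseteq> X ` U \<union> Y ` U}"

lemma keys_plus_nat: "keys (a + b) = keys a \<union> keys b" for a b :: "'a \<Rightarrow>\<^sub>0 nat"
  by (auto simp: in_keys_iff lookup_add)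

lemma plus_in_monomials_on: "a + b \<in> monomials_on U \<longleftrightarrow> a \<in> monomials_on U \<and> b \<in> monomials_on U"
  by (auto simp: monomials_on_def keys_plus_nat)

lemma monomials_on_mono: "U \<subseteq> V \<Longrightarrow> monomials_on U \<subseteq> monomials_on V"
  unfolding monomials_on_def by blast

lemma zero_in_monomials_on: "0 \<in> monomials_on U"
  by (simp add: monomials_on_def)

lemma single_in_monomials_on:
  "i \<in> U \<Longrightarrow> single (X i) k \<in> monomials_on U" "i \<in> U \<Longrightarrow> single (Y i) k \<in> monomials_on U"
  by (auto simp: monomials_on_def)

lemma carrier_poly_ring: "p \<in> carrier (poly_ring n) \<longleftrightarrow> keys p \<subseteq> monomials_on {1..n}"
  by (auto simp: poly_ring_def monomials_on_def indets_def)

lemma poly_ring_ops [simp]: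
  "x \<otimes>\<^bsub>poly_ring n\<^esub> y = x * y" "x \<oplus>\<^bsub>poly_ring n\<^esub> y = x + y"
  "\<one>\<^bsub>poly_ring n\<^esub> = 1" "\<zero>\<^bsub>poly_ring n\<^esub> = 0"
  by (simp_all add: poly_ring_def)

lemma poly_closed:
  fixes p q :: "'k::field mpoly"
  shows poly_zero_closed: "(0 :: 'k mpoly) \<in> carrier (poly_ring n)"
    and poly_one_closed: "(1 :: 'k mpoly) \<in> carrier (poly_ring n)"
    and poly_add_closed: "p \<in> carrier (poly_ring n) \<Longrightarrow> q \<in> carrier (poly_ring n) \<Longrightarrow> p + q \<in> carrier (poly_ring n)"
    and poly_diff_closed: "p \<in> carrier (poly_ring n) \<Longrightarrow> q \<in> carrier (poly_ring n) \<Longrightarrow> p - q \<in> carrier (poly_ring n)"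
    and poly_uminus_closed: "p \<in> carrier (poly_ring n) \<Longrightarrow> - p \<in> carrier (poly_ring n)"
    and poly_mult_closed: "p \<in> carrier (poly_ring n) \<Longrightarrow> q \<in> carrier (poly_ring n) \<Longrightarrow> p * q \<in> carrier (poly_ring n)"
proof -
  show "p * q \<in> carrier (poly_ring n)" if "p \<in> carrier (poly_ring n)" "q \<in> carrier (poly_ring n)"
    using that keys_mult[of p q] plus_in_monomials_on[of _ _ "{1..n}"]
    unfolding carrier_poly_ring by (fastforce simp: subset_iff)
  show "p - q \<in> carrier (poly_ring n)" if "p \<in> carrier (poly_ring n)" "q \<in> carrier (poly_ring n)"
    using that keys_diff[of p q] unfolding carrier_poly_ring by blast
  show "p + q \<in> carrier (poly_ring n)" if "p \<in> carrier (poly_ring n)" "q \<in> carrier (poly_ring n)"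
    using that keys_add[of p q] unfolding carrier_poly_ring by blast
qed (auto simp: carrier_poly_ring zero_in_monomials_on)

lemma single_closed: "m \<in> monomials_on {1..n} \<Longrightarrow> single m c \<in> carrier (poly_ring n)"
  by (auto simp: carrier_poly_ring)

lemma indet_poly_closed:
  "i \<in> {1..n} \<Longrightarrow> indet_poly (X i) \<in> carrier (poly_ring n)"
  "i \<in> {1..n} \<Longrightarrow> indet_poly (Y i) \<in> carrier (poly_ring n)"
  by (simp_all add: indet_poly_def single_closed single_in_monomials_on)

lemma edge_binomial_closed:
  "i \<in> {1..n} \<Longrightarrow> j \<in> {1..n} \<Longrightarrow> edge_binomial i j \<in> carrier (poly_ring n)"
  unfolding edge_binomial_def by (intro poly_diff_closed poly_mult_closed indet_poly_closed)

lemma edge_binomial_swap: "edge_binomial j i = - edge_binomial i j"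
  by (simp add: edge_binomial_def algebra_simps)

lemma edge_binomial_refl [simp]: "edge_binomial i i = 0"
  by (simp add: edge_binomial_def)

lemma cring_poly_ring: "cring (poly_ring n :: 'k::field mpoly ring)"
proof (rule cringI)
  show "abelian_group (poly_ring n :: 'k mpoly ring)"
  proof (rule abelian_groupI)
    show "\<exists>y\<in>carrier (poly_ring n). y \<oplus>\<^bsub>poly_ring n\<^esub> x = \<zero>\<^bsub>poly_ring n\<^esub>"
      if "x \<in> carrier (poly_ring n)" for x :: "'k mpoly"
      by (rule bexI[of _ "- x"]) (auto simp: poly_uminus_closed that)
  qed (auto simp: poly_closed algebra_simps)
  show "comm_monoid (poly_ring n :: 'k mpoly ring)"
    by (rule comm_monoidI) (auto simp: poly_closed algebra_simps)
qed (auto simp: algebra_simps)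

text \<open>All ideals below are handled through this characterisation and its consequences, in the arithmetic of
  the type of polynomials instead of the ring record.\<close>

lemma ideal_poly_ring_iff:
  fixes I :: "'k::field mpoly set"
  shows "ideal I (poly_ring n) \<longleftrightarrow>
    I \<subseteq> carrier (poly_ring n) \<and> 0 \<in> I \<and> (\<forall>a\<in>I. \<forall>b\<in>I. a + b \<in> I) \<and>
    (\<forall>a\<in>I. \<forall>x\<in>carrier (poly_ring n). x * a \<in> I)" (is "_ \<longleftrightarrow> ?R")
proof
  interpret R: cring "poly_ring n :: 'k mpoly ring" by (rule cring_poly_ring)
  show ?R if "ideal I (poly_ring n)"
  proof -
    interpret ideal I "poly_ring n" by fact
    show ?thesis
      using a_subset zero_closed a_closed I_l_closed by auto
  qed
  show "ideal I (poly_ring n)" if R: ?R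
  proof (rule idealI)
    show "subgroup I (add_monoid (poly_ring n))"
    proof (rule R.add.subgroupI)
      show "\<ominus>\<^bsub>poly_ring n\<^esub> a \<in> I" if a: "a \<in> I" for a
      proof -
        have "a \<in> carrier (poly_ring n)" using R a by blast
        then have "\<ominus>\<^bsub>poly_ring n\<^esub> a = - 1 * a"
          by (intro R.minus_equality) (auto simp: poly_uminus_closed)
        moreover have "- 1 * a \<in> I"
          using R a by (blast intro: poly_uminus_closed poly_one_closed)
        ultimately show ?thesis by simp
      qed
    qed (use R in auto)
  qed (use R R.ring_axioms in \<open>auto simp: mult.commute\<close>)
qed

lemma ideal_closed:
  fixes I :: "'k::field mpoly set"
  assumes "ideal I (poly_ring n)"
  shows ideal_zero: "0 \<in> I"
    and ideal_add: "a \<in> I \<Longrightarrow> b \<in> I \<Longrightarrow> a + b \<in> I"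
    and ideal_mult: "a \<in> I \<Longrightarrow> x \<in> carrier (poly_ring n) \<Longrightarrow> x * a \<in> I"
    and ideal_uminus: "a \<in> I \<Longrightarrow> - a \<in> I"
    and ideal_diff: "a \<in> I \<Longrightarrow> b \<in> I \<Longrightarrow> a - b \<in> I"
proof -
  show z: "0 \<in> I" and add: "\<And>a b. a \<in> I \<Longrightarrow> b \<in> I \<Longrightarrow> a + b \<in> I"
    and mult: "\<And>a x. a \<in> I \<Longrightarrow> x \<in> carrier (poly_ring n) \<Longrightarrow> x * a \<in> I"
    using assms by (auto simp: ideal_poly_ring_iff)
  show um: "- a \<in> I" if "a \<in> I" for a
    using mult[OF that, of "- 1"] by (simp add: poly_uminus_closed poly_one_closed)
  show "a - b \<in> I" if "a \<in> I" "b \<in> I"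
    using add[OF that(1) um[OF that(2)]] by simp
qed

lemma ideal_colon:
  assumes I: "ideal I (poly_ring n)" and f: "f \<in> carrier (poly_ring n)"
  shows "ideal (colon (poly_ring n) I f) (poly_ring n)"
  unfolding ideal_poly_ring_iff colon_def
  using ideal_closed[OF I] by (auto simp: poly_closed distrib_right mult.assoc)

lemma genideal_poly_ring:
  fixes B :: "'k::field mpoly set"
  assumes "B \<subseteq> carrier (poly_ring n)"
  shows "ideal (Idl\<^bsub>poly_ring n\<^esub> B) (poly_ring n)" "B \<subseteq> Idl\<^bsub>poly_ring n\<^esub> B"
    "\<And>I. ideal I (poly_ring n) \<Longrightarrow> B \<subseteq> I \<Longrightarrow> Idl\<^bsub>poly_ring n\<^esub> B \<subseteq> I"
proof -
  interpret R: cring "poly_ring n :: 'k mpoly ring" by (rule cring_poly_ring)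
  show "ideal (Idl\<^bsub>poly_ring n\<^esub> B) (poly_ring n)" "B \<subseteq> Idl\<^bsub>poly_ring n\<^esub> B"
    "\<And>I. ideal I (poly_ring n) \<Longrightarrow> B \<subseteq> I \<Longrightarrow> Idl\<^bsub>poly_ring n\<^esub> B \<subseteq> I"
    using R.genideal_ideal[OF assms] R.genideal_self[OF assms] R.genideal_minimal by auto
qed

text \<open>Since \<open>f\<^sub>j\<^sub>i = - f\<^sub>i\<^sub>j\<close>, the ideal contains the binomials of an edge in both orientations, which spares the
  arguments below a distinction of the order of the endpoints.\<close>

lemma binomial_edge_ideal_generated:
  fixes n E
  assumes E: "simple_graph n E"
  defines "J \<equiv> binomial_edge_ideal n E :: 'k::field mpoly set"
  shows "ideal J (poly_ring n)"
    and "{i, j} \<in> E \<Longrightarrow> edge_binomial i j \<in> J"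
    and "ideal I (poly_ring n) \<Longrightarrow> (\<And>i j. {i, j} \<in> E \<Longrightarrow> edge_binomial i j \<in> I) \<Longrightarrow> J \<subseteq> I"
proof -
  let ?B = "{edge_binomial i j |i j. {i, j} \<in> E \<and> i < j} :: 'k mpoly set"
  have B: "?B \<subseteq> carrier (poly_ring n)"
    using E by (fastforce simp: simple_graph_def intro!: edge_binomial_closed)
  note gen = genideal_poly_ring[OF B, folded binomial_edge_ideal_def J_def]
  show J: "ideal J (poly_ring n)" by (rule gen)
  show "edge_binomial i j \<in> J" if ij: "{i, j} \<in> E"
  proof (cases i j rule: linorder_cases)
    case greater
    then have "{j, i} \<in> E \<and> j < i" using ij by (simp add: insert_commute)
    then have "edge_binomial j i \<in> ?B" by blast
    then have "edge_binomial j i \<in> J" using gen(2) by blast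
    then show ?thesis using ideal_uminus[OF J, of "edge_binomial j i"] by (simp add: edge_binomial_swap[of i j])
  qed (use gen(2) ij ideal_zero[OF J] in auto)
  show "J \<subseteq> I" if "ideal I (poly_ring n)" "\<And>i j. {i, j} \<in> E \<Longrightarrow> edge_binomial i j \<in> I"
    using that by (intro gen(3)) auto
qed


section \<open>Connected components\<close>

definition component :: "nat set set \<Rightarrow> nat \<Rightarrow> nat" where
  "component E i = (LEAST j. same_component E i j)"

lemma same_component_refl: "same_component E i i"
  by (simp add: same_component_def)

lemma same_component_edge: "{i, j} \<in> E \<Longrightarrow> same_component E i j"
  by (auto simp: same_component_def)

lemma same_component_trans:
  "same_component E i j \<Longrightarrow> same_component E j k \<Longrightarrow> same_component E i k"
  unfolding same_component_def by (rule rtrancl_trans)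

lemma same_component_sym: "same_component E i j \<Longrightarrow> same_component E j i"
proof -
  have "sym {(a, b). {a, b} \<in> E}" by (auto simp: sym_def insert_commute)
  then show "same_component E i j \<Longrightarrow> same_component E j i"
    unfolding same_component_def by (meson sym_rtrancl symD)
qed

lemma same_component_mono:
  assumes "E \<subseteq> F" "same_component E i j" shows "same_component F i j"
proof -
  have "{(a, b). {a, b} \<in> E} \<subseteq> {(a, b). {a, b} \<in> F}" using assms(1) by auto
  from rtrancl_mono[OF this] show ?thesis using assms(2) unfolding same_component_def by auto
qed

lemma component_eq_iff: "component E i = component E j \<longleftrightarrow> same_component E i j"
proof
  have least: "same_component E i (component E i)" for i
    unfolding component_def by (rule LeastI, rule same_component_refl)
  show "same_component E i j" if "component E i = component E j"
    using least[of i] same_component_sym[OF least[of j]] that by (auto intro: same_component_trans)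
  show "component E i = component E j" if "same_component E i j"
  proof -
    have "same_component E i k \<longleftrightarrow> same_component E j k" for k
      using that same_component_sym[OF that] by (blast intro: same_component_trans)
    then show ?thesis by (simp add: component_def)
  qed
qed

lemma P_empty_generated:
  fixes n E
  defines "P \<equiv> P_empty n E :: 'k::field mpoly set"
  shows "ideal P (poly_ring n)"
    and "i \<in> {1..n} \<Longrightarrow> j \<in> {1..n} \<Longrightarrow> same_component E i j \<Longrightarrow> edge_binomial i j \<in> P"
    and "ideal I (poly_ring n) \<Longrightarrow>
      (\<And>i j. i \<in> {1..n} \<Longrightarrow> j \<in> {1..n} \<Longrightarrow> same_component E i j \<Longrightarrow> edge_binomial i j \<in> I) \<Longrightarrow> P \<subseteq> I"
proof -
  let ?B = "{edge_binomial i j |i j. i \<in> {1..n} \<and> j \<in> {1..n} \<and> i < j \<and> same_component E i j} :: 'k mpoly set"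
  have B: "?B \<subseteq> carrier (poly_ring n)"
    by (auto intro!: edge_binomial_closed)
  note gen = genideal_poly_ring[OF B, folded P_empty_def P_def]
  show P: "ideal P (poly_ring n)" by (rule gen)
  show "edge_binomial i j \<in> P"
    if ij: "i \<in> {1..n}" "j \<in> {1..n}" "same_component E i j"
  proof (cases i j rule: linorder_cases)
    case less
    then show ?thesis using gen(2) ij by blast
  next
    case greater
    then have "edge_binomial j i \<in> P" using gen(2) ij same_component_sym by blast
    then show ?thesis using ideal_uminus[OF P, of "edge_binomial j i"] by (simp add: edge_binomial_swap[of i j])
  qed (use ideal_zero[OF P] in auto)
  show "P \<subseteq> I" if "ideal I (poly_ring n)"
    "\<And>i j. i \<in> {1..n} \<Longrightarrow> j \<in> {1..n} \<Longrightarrow> same_component E i j \<Longrightarrow> edge_binomial i j \<in> I"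
    using that by (intro gen(3)) auto
qed


section \<open>The toric parametrisation\<close>

text \<open>The exponent vectors of \<open>s\<^sub>i a\<^sub>c\<close> and \<open>s\<^sub>i\<close>. The target variables are numbered by natural numbers, the
  \<open>s\<^sub>i\<close> by the even and the \<open>a\<^sub>c\<close> by the odd ones, because the polynomials over a linearly ordered set of
  variables are an instance of \<^class>\<open>idom\<close>.\<close>

fun indet_weight :: "nat set set \<Rightarrow> indet \<Rightarrow> (nat \<Rightarrow>\<^sub>0 nat)" where
  "indet_weight E (X i) = single (2 * i) 1 + single (2 * component E i + 1) 1"
| "indet_weight E (Y i) = single (2 * i) 1"

definition weight :: "nat set set \<Rightarrow> monom \<Rightarrow> (nat \<Rightarrow>\<^sub>0 nat)" where
  "weight E m = (\<Sum>z\<in>keys m. of_nat (lookup m z) * indet_weight E z)"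

lemma weight_superset:
  assumes "finite A" "keys m \<subseteq> A"
  shows "weight E m = (\<Sum>z\<in>A. of_nat (lookup m z) * indet_weight E z)"
  unfolding weight_def
  by (rule sum.mono_neutral_left) (use assms in \<open>auto simp: in_keys_iff\<close>)

lemma weight_add: "weight E (a + b) = weight E a + weight E b"
  by (simp add: weight_superset[of "keys a \<union> keys b"] keys_plus_nat lookup_add
      distrib_right sum.distrib)

lemma weight_indet: "weight E (single z 1) = indet_weight E z"
  by (simp add: weight_def)

lemma lookup_of_nat_mult: "lookup (of_nat k * p) a = k * lookup p a" for p :: "nat \<Rightarrow>\<^sub>0 nat"
  by (induction k) (auto simp: algebra_simps lookup_add)

lemma lookup_weight_even: "lookup (weight E m) (2 * i) = lookup m (X i) + lookup m (Y i)"
proof -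
  have [simp]: "2 * i \<noteq> Suc (2 * k)" "Suc (2 * k) \<noteq> 2 * i" for k by presburger+
  let ?A = "keys m \<union> {X i, Y i}"
  have "lookup (weight E m) (2 * i)
      = (\<Sum>z\<in>?A. lookup m z * lookup (indet_weight E z) (2 * i))"
    by (subst weight_superset[of ?A]) (auto simp: lookup_sum lookup_of_nat_mult)
  also have "\<dots> = (\<Sum>z\<in>{X i, Y i}. lookup m z * lookup (indet_weight E z) (2 * i))"
  proof (rule sum.mono_neutral_right)
    show "\<forall>z\<in>?A - {X i, Y i}. lookup m z * lookup (indet_weight E z) (2 * i) = 0"
    proof
      fix z assume "z \<in> ?A - {X i, Y i}"
      then show "lookup m z * lookup (indet_weight E z) (2 * i) = 0"
        by (cases z) (auto simp: lookup_add lookup_single when_def)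
    qed
  qed auto
  finally show ?thesis by (simp add: lookup_add lookup_single when_def)
qed

lemma lookup_weight_odd:
  assumes A: "finite A" "\<And>i. X i \<in> keys m \<Longrightarrow> i \<in> A"
  shows "lookup (weight E m) (2 * k + 1) = (\<Sum>i | i \<in> A \<and> component E i = k. lookup m (X i))"
proof -
  have [simp]: "2 * i \<noteq> Suc (2 * k)" "Suc (2 * k) \<noteq> 2 * i" for k i :: nat by presburger+
  let ?A = "keys m \<union> X ` A" and ?B = "X ` {i \<in> A. component E i = k}"
  have "lookup (weight E m) (2 * k + 1)
      = (\<Sum>z\<in>?A. lookup m z * lookup (indet_weight E z) (2 * k + 1))"
    by (subst weight_superset[of ?A]) (auto simp: lookup_sum lookup_of_nat_mult A)
  also have "\<dots> = (\<Sum>z\<in>?B. lookup m z * lookup (indet_weight E z) (2 * k + 1))"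
  proof (rule sum.mono_neutral_right)
    show "\<forall>z\<in>?A - ?B. lookup m z * lookup (indet_weight E z) (2 * k + 1) = 0"
    proof
      fix z assume "z \<in> ?A - ?B"
      then show "lookup m z * lookup (indet_weight E z) (2 * k + 1) = 0"
        using A(2) by (cases z) (auto simp: lookup_add lookup_single when_def)
    qed
  qed (use A in auto)
  also have "\<dots> = (\<Sum>i | i \<in> A \<and> component E i = k. lookup m (X i))"
    by (subst sum.reindex) (auto simp: inj_on_def lookup_add lookup_single when_def intro!: sum.cong)
  finally show ?thesis .
qed

text \<open>Composition of the toric map of \<open>E\<close> with setting to \<open>0\<close> the variables of the vertices outside \<open>U\<close>.\<close>

definition weight_image :: "nat set set \<Rightarrow> nat set \<Rightarrow> 'k::field mpoly \<Rightarrow> (nat \<Rightarrow>\<^sub>0 nat) \<Rightarrow>\<^sub>0 'k" where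
  "weight_image E U = pushforward (weight E) (monomials_on U)"

lemma weight_image_simps:
  shows weight_image_zero: "weight_image E U 0 = 0"
    and weight_image_add: "weight_image E U (p + q) = weight_image E U p + weight_image E U q"
    and weight_image_diff: "weight_image E U (p - q) = weight_image E U p - weight_image E U q"
    and weight_image_mult: "weight_image E U (p * q) = weight_image E U p * weight_image E U q"
    and weight_image_single:
      "weight_image E U (single m c) = (if m \<in> monomials_on U then single (weight E m) c else 0)"
  by (simp_all add: weight_image_def pushforward_add pushforward_diff pushforward_mult
      pushforward_single weight_add plus_in_monomials_on)

lemma weight_image_indet:
  "weight_image E U (indet_poly (X i)) = (if i \<in> U then single (indet_weight E (X i)) 1 else 0)"
  "weight_image E U (indet_poly (Y i)) = (if i \<in> U then single (indet_weight E (Y i)) 1 else 0)"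
  unfolding indet_poly_def weight_image_single weight_indet by (auto simp: monomials_on_def)

lemma weight_image_edge_binomial:
  "weight_image E U (edge_binomial i j :: 'k::field mpoly) = 0 \<longleftrightarrow>
    i \<notin> U \<or> j \<notin> U \<or> same_component E i j"
proof (cases "i \<in> U \<and> j \<in> U")
  case True
  let ?a = "indet_weight E (X i) + indet_weight E (Y j)"
    and ?b = "indet_weight E (X j) + indet_weight E (Y i)"
  have "weight_image E U (edge_binomial i j :: 'k mpoly) = single ?a 1 - single ?b 1"
    using True unfolding edge_binomial_def weight_image_diff weight_image_mult weight_image_indet
    by (simp add: mult_single)
  then have "weight_image E U (edge_binomial i j :: 'k mpoly) = 0 \<longleftrightarrow> ?a = ?b"
    by simp (metis lookup_single_eq lookup_single_not_eq zero_neq_one)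
  also have "\<dots> \<longleftrightarrow> component E i = component E j"
  proof
    have [simp]: "2 * i \<noteq> Suc (2 * k)" "Suc (2 * k) \<noteq> 2 * i" for k i :: nat by presburger+
    assume "?a = ?b"
    then have "lookup ?a (2 * component E i + 1) = lookup ?b (2 * component E i + 1)" by simp
    then show "component E i = component E j"
      by (auto simp: lookup_add lookup_single when_def split: if_splits)
  qed (simp add: ac_simps)
  finally show ?thesis using True by (simp add: component_eq_iff)
next
  case False
  then show ?thesis
    unfolding edge_binomial_def weight_image_diff weight_image_mult weight_image_indet by auto
qed

lemma ideal_weight_kernel:
  "ideal {p \<in> carrier (poly_ring n). weight_image E U p = 0} (poly_ring n)"
  by (auto simp: ideal_poly_ring_iff poly_closed weight_image_simps)

lemma ex_greater_if_sum_eq: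
  fixes f g :: "'a \<Rightarrow> nat"
  assumes "finite A" "sum f A = sum g A" "a \<in> A" "f a \<noteq> g a"
  shows "\<exists>i\<in>A. f i > g i"
proof (rule ccontr)
  assume "\<not> ?thesis"
  then have "\<forall>i\<in>A. f i \<le> g i" by (simp add: not_less)
  moreover from this have "f a < g a" using assms by (simp add: le_neq_implies_less)
  ultimately have "sum f A < sum g A" using assms by (intro sum_strict_mono_ex1) auto
  with assms show False by simp
qed

text \<open>The degree in \<open>x\<^sub>i, y\<^sub>i\<close> and the total degree in the \<open>x\<close>-variables of each component can be read off the
  weight. So if \<open>m\<close> and \<open>m'\<close> differ, they differ in the exponent of an \<open>x\<close>-variable, and within its
  component an excess at one vertex is balanced by a deficit at another.\<close>

lemma weight_eq_obtains_swap:
  assumes w: "weight E m = weight E m'" and ne: "m \<noteq> m'"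
  obtains i j where "same_component E i j" "lookup m (X i) > lookup m' (X i)"
    "lookup m (X j) < lookup m' (X j)"
proof -
  have deg: "lookup m (X i) + lookup m (Y i) = lookup m' (X i) + lookup m' (Y i)" for i
    using w lookup_weight_even[of E m i] lookup_weight_even[of E m' i] by simp
  obtain i0 where i0: "lookup m (X i0) \<noteq> lookup m' (X i0)"
  proof -
    obtain z where z: "lookup m z \<noteq> lookup m' z" using ne by (auto simp: poly_mapping_eq_iff fun_eq_iff)
    obtain i where "z = X i \<or> z = Y i" by (cases z) auto
    with z deg[of i] have "lookup m (X i) \<noteq> lookup m' (X i)" by auto
    then show thesis by (rule that)
  qed
  define A where "A = {i. X i \<in> keys m \<union> keys m'}"
  have "finite A"
    unfolding A_def by (rule finite_vimageI[of _ X, unfolded vimage_def]) (auto simp: inj_on_def)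
  define C where "C = {i. i \<in> A \<and> component E i = component E i0}"
  have "finite C" using \<open>finite A\<close> by (auto simp: C_def)
  have i0C: "i0 \<in> C" using i0 by (auto simp: C_def A_def in_keys_iff)
  have eq: "(\<Sum>i\<in>C. lookup m (X i)) = (\<Sum>i\<in>C. lookup m' (X i))"
    unfolding C_def using w \<open>finite A\<close>
    by (subst (1 2) lookup_weight_odd[symmetric]) (auto simp: A_def)
  obtain i where i: "i \<in> C" "lookup m (X i) > lookup m' (X i)"
    using ex_greater_if_sum_eq[OF \<open>finite C\<close> eq i0C i0] by blast
  obtain j where j: "j \<in> C" "lookup m' (X j) > lookup m (X j)"
    using ex_greater_if_sum_eq[OF \<open>finite C\<close> eq[symmetric] i0C i0[symmetric]] by blast
  have "same_component E i j"
    using i(1) j(1) by (simp add: C_def flip: component_eq_iff)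
  with i(2) j(2) that show thesis by blast
qed

text \<open>With \<open>i, j\<close> from the preceding lemma, the deficit of \<open>m\<close> in \<open>x\<^sub>j\<close> is an excess in \<open>y\<^sub>j\<close>, so \<open>x\<^sub>i y\<^sub>j\<close> divides \<open>m\<close>; replacing it by \<open>x\<^sub>j y\<^sub>i\<close> changes \<open>m\<close> by a multiple
  of \<open>f\<^sub>i\<^sub>j\<close> and brings it closer to \<open>m'\<close>.\<close>

lemma monomials_congruent:
  fixes I :: "'k::field mpoly set"
  assumes I: "ideal I (poly_ring n)"
    and gen: "\<And>i j. i \<in> {1..n} \<Longrightarrow> j \<in> {1..n} \<Longrightarrow> same_component E i j \<Longrightarrow> edge_binomial i j \<in> I"
    and m': "m' \<in> monomials_on {1..n}"
  shows "m \<in> monomials_on {1..n} \<Longrightarrow> weight E m = weight E m' \<Longrightarrow> single m 1 - single m' 1 \<in> I"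
proof (induction "\<Sum>z\<in>indets n. lookup m z - lookup m' z" arbitrary: m rule: less_induct)
  case less
  show ?case
  proof (cases "m = m'")
    case False
    obtain i j where ij: "same_component E i j" "lookup m (X i) > lookup m' (X i)"
      "lookup m (X j) < lookup m' (X j)"
      using weight_eq_obtains_swap[OF less.prems(2) False] .
    have deg: "lookup m (X k) + lookup m (Y k) = lookup m' (X k) + lookup m' (Y k)" for k
      using less.prems(2) lookup_weight_even[of E m k] lookup_weight_even[of E m' k] by simp
    have Y: "lookup m (Y j) > lookup m' (Y j)" "lookup m (Y i) < lookup m' (Y i)"
      using deg[of i] deg[of j] ij by auto
    have "i \<noteq> j" using ij by auto
    have ijn: "i \<in> {1..n}" "j \<in> {1..n}"
    proof -
      have "X i \<in> keys m" "X j \<in> keys m'" using ij by (auto simp: in_keys_iff)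
      then show "i \<in> {1..n}" "j \<in> {1..n}"
        using less.prems(1) m' unfolding monomials_on_def by blast+
    qed
    define s where "s = m - single (X i) 1 - single (Y j) 1"
    define m1 where "m1 = s + single (X j) 1 + single (Y i) 1"
    have m: "m = s + single (X i) 1 + single (Y j) 1"
      using ij Y by (intro poly_mapping_eqI) (auto simp: s_def lookup_add lookup_minus lookup_single when_def)
    have "s \<in> monomials_on {1..n}"
      using less.prems(1) m plus_in_monomials_on by metis
    then have m1: "m1 \<in> monomials_on {1..n}"
      using ijn by (simp add: m1_def plus_in_monomials_on single_in_monomials_on)
    have w1: "weight E m1 = weight E m'"
    proof -
      have "component E i = component E j" using ij by (simp add: component_eq_iff)
      then have "weight E m1 = weight E m"
        by (simp add: m m1_def weight_add weight_indet[simplified] ac_simps)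
      then show ?thesis using less.prems by simp
    qed
    have lk: "lookup m1 z = (if z = X i \<or> z = Y j then lookup m z - 1
        else if z = X j \<or> z = Y i then lookup m z + 1 else lookup m z)" for z
      using \<open>i \<noteq> j\<close> by (auto simp: m m1_def lookup_add lookup_single when_def)
    have "(\<Sum>z\<in>indets n. lookup m1 z - lookup m' z) < (\<Sum>z\<in>indets n. lookup m z - lookup m' z)"
    proof (rule sum_strict_mono_ex1)
      show "\<forall>z\<in>indets n. lookup m1 z - lookup m' z \<le> lookup m z - lookup m' z"
        using ij Y by (auto simp: lk)
      show "\<exists>z\<in>indets n. lookup m1 z - lookup m' z < lookup m z - lookup m' z"
        using ij ijn by (intro bexI[of _ "X i"]) (auto simp: lk indets_def)
    qed (simp add: indets_def)
    from less.hyps[OF this m1 w1] have IH: "single m1 1 - single m' 1 \<in> I" .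
    have "single m 1 - single m1 1 = (single s 1 :: 'k mpoly) * edge_binomial i j"
      by (simp add: edge_binomial_def indet_poly_def right_diff_distrib mult_single m m1_def ac_simps)
    also have "\<dots> \<in> I"
      using I gen[OF ijn ij(1)] \<open>s \<in> _\<close> by (intro ideal_mult single_closed)
    finally have "(single m 1 - single m1 1) + (single m1 1 - single m' 1) \<in> I"
      using IH by (rule ideal_add[OF I])
    then show ?thesis by simp
  qed (simp add: ideal_zero[OF I])
qed

text \<open>In an element of the kernel, the coefficients over one weight add up to \<open>0\<close>, so no weight occurs on a single
  monomial. Moving a coefficient from one monomial to another of the same weight is a change by an
  element of \<open>I\<close> and removes a monomial.\<close>

lemma kernel_subset_ideal:
  fixes I :: "'k::field mpoly set"
  assumes I: "ideal I (poly_ring n)"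
    and gen: "\<And>i j. i \<in> {1..n} \<Longrightarrow> j \<in> {1..n} \<Longrightarrow> same_component E i j \<Longrightarrow> edge_binomial i j \<in> I"
  shows "p \<in> carrier (poly_ring n) \<Longrightarrow> weight_image E {1..n} p = 0 \<Longrightarrow> p \<in> I"
proof (induction "card (keys p)" arbitrary: p rule: less_induct)
  case less
  show ?case
  proof (cases "p = 0")
    case False
    then obtain m where m: "m \<in> keys p" by fastforce
    have on: "keys p \<subseteq> monomials_on {1..n}"
      using less.prems(1) by (simp add: carrier_poly_ring)
    let ?C = "{a. a \<in> keys p \<inter> monomials_on {1..n} \<and> weight E a = weight E m}"
    have "lookup (weight_image E {1..n} p) (weight E m) = 0"
      unfolding less.prems(2) by simp
    then have "(\<Sum>a\<in>?C. lookup p a) = 0"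
      by (simp only: weight_image_def lookup_pushforward)
    moreover have "lookup p m \<noteq> 0" using m by (simp add: in_keys_iff)
    ultimately have "?C \<noteq> {m}" by auto
    moreover have "m \<in> ?C" using m on by blast
    ultimately obtain m' where m': "m' \<in> keys p" "weight E m = weight E m'" "m' \<noteq> m"
      by fastforce
    \<comment> \<open>Subtracting \<open>r\<close> moves the coefficient of \<open>m\<close> to \<open>m'\<close>.\<close>
    define r where "r = single 0 (lookup p m) * (single m 1 - single m' 1)"
    have cong: "single m 1 - single m' 1 \<in> I"
      using monomials_congruent[OF I gen] m m' on by blast
    have r: "r \<in> I"
      unfolding r_def using cong by (intro ideal_mult[OF I] single_closed zero_in_monomials_on)
    have r_eq: "r = single m (lookup p m) - single m' (lookup p m)"
      by (simp add: r_def right_diff_distrib mult_single)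
    have "keys (p - r) \<subseteq> keys p - {m}"
      using m m' by (auto simp: r_eq in_keys_iff lookup_minus lookup_single when_def split: if_splits)
    then have "card (keys (p - r)) < card (keys p)"
      using m by (intro psubset_card_mono) auto
    moreover have "p - r \<in> carrier (poly_ring n)"
      using \<open>keys (p - r) \<subseteq> _\<close> on by (auto simp: carrier_poly_ring)
    moreover have "weight_image E {1..n} (p - r) = 0"
      using less.prems(2) m m' on by (auto simp: r_eq weight_image_simps)
    ultimately have "p - r \<in> I" by (rule less.hyps)
    from ideal_add[OF I this r] show ?thesis by simp
  qed (simp add: ideal_zero[OF I])
qed

theorem P_empty_eq_kernel:
  "P_empty n E = {p \<in> carrier (poly_ring n). weight_image E {1..n} p = (0 :: _ \<Rightarrow>\<^sub>0 'k::field)}"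
proof
  show "P_empty n E \<subseteq> {p \<in> carrier (poly_ring n). weight_image E {1..n} p = (0 :: _ \<Rightarrow>\<^sub>0 'k)}"
    by (rule P_empty_generated(3)[OF ideal_weight_kernel])
      (simp add: weight_image_edge_binomial edge_binomial_closed)
  show "{p \<in> carrier (poly_ring n). weight_image E {1..n} p = (0 :: _ \<Rightarrow>\<^sub>0 'k)} \<subseteq> P_empty n E"
    using kernel_subset_ideal[OF P_empty_generated(1,2)] by auto
qed

text \<open>The toric map goes to an integral domain.\<close>

lemma primeideal_P_empty: "primeideal (P_empty n E :: 'k::field mpoly set) (poly_ring n)"
proof (rule primeidealI[OF P_empty_generated(1) cring_poly_ring])
  have "weight_image E {1..n} (1 :: 'k mpoly) \<noteq> 0"
    unfolding single_one[symmetric] weight_image_single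
    by (simp add: zero_in_monomials_on del: single_one) (metis lookup_single_eq lookup_zero one_neq_zero)
  then show "carrier (poly_ring n) \<noteq> (P_empty n E :: 'k mpoly set)"
    using poly_one_closed[of n] by (auto simp: P_empty_eq_kernel)
qed (auto simp: P_empty_eq_kernel weight_image_mult)

text \<open>An edge with an endpoint outside \<open>U\<close> gives a binomial all of whose terms are sent to \<open>0\<close>; the other edges
  only need to lie within the components of \<open>F\<close>.\<close>

lemma binomial_edge_ideal_weight_image:
  assumes E: "simple_graph n E" and F: "\<And>i j. {i, j} \<in> E \<Longrightarrow> i \<in> U \<Longrightarrow> j \<in> U \<Longrightarrow> same_component F i j"
    and p: "p \<in> binomial_edge_ideal n E"
  shows "weight_image F U p = 0"
proof -
  have "binomial_edge_ideal n E \<subseteq> {p \<in> carrier (poly_ring n). weight_image F U p = 0}"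
    using E F by (intro binomial_edge_ideal_generated(3)[OF E ideal_weight_kernel])
      (auto simp: weight_image_edge_binomial simple_graph_def intro!: edge_binomial_closed)
  with p show ?thesis by auto
qed

lemma binomial_edge_ideal_subset_P_empty:
  assumes "simple_graph n E"
  shows "binomial_edge_ideal n E \<subseteq> P_empty n E"
  using assms by (intro binomial_edge_ideal_generated(3) P_empty_generated) (auto simp: simple_graph_def intro: same_component_edge)


section \<open>Completion sets\<close>

lemma simple_graph_complete_at: "simple_graph n E \<Longrightarrow> simple_graph n (complete_at v E)"
  by (fastforce simp: simple_graph_def complete_at_def neighbours_def)

lemma complete_at_same_component:
  assumes "{i, j} \<in> complete_at v E" shows "same_component E i j"
proof (cases "{i, j} \<in> E")
  case False
  then have "{v, i} \<in> E" "{v, j} \<in> E"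
    using assms by (auto simp: complete_at_def neighbours_def doubleton_eq_iff)
  then show ?thesis
    by (meson same_component_edge same_component_sym same_component_trans)
qed (rule same_component_edge)

lemma fold_complete_at:
  assumes "simple_graph n E"
  shows "simple_graph n (fold complete_at vs E)"
    and "E \<subseteq> fold complete_at vs E"
    and "{i, j} \<in> fold complete_at vs E \<Longrightarrow> same_component E i j"
proof -
  have "simple_graph n (fold complete_at vs E) \<and> E \<subseteq> fold complete_at vs E \<and>
      (\<forall>i j. {i, j} \<in> fold complete_at vs E \<longrightarrow> same_component E i j)"
    using assms
  proof (induction vs arbitrary: E)
    case (Cons v vs)
    have "E \<subseteq> complete_at v E" by (auto simp: complete_at_def)
    moreover have "same_component E i j" if "same_component (complete_at v E) i j" for i j
      using that unfolding same_component_def[of "complete_at v E"]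
      by induction (auto intro: same_component_refl same_component_trans complete_at_same_component)
    ultimately show ?case
      using Cons.IH[OF simple_graph_complete_at[OF Cons.prems, of v]] by (simp add: subset_iff)
  qed (auto intro: same_component_edge)
  then show "simple_graph n (fold complete_at vs E)" "E \<subseteq> fold complete_at vs E"
    "{i, j} \<in> fold complete_at vs E \<Longrightarrow> same_component E i j" by auto
qed

text \<open>Completing never joins different components, so once every component is complete, the components
  are the blocks of the required partition.\<close>

lemma completion_setI:
  assumes E: "simple_graph n E" and W: "W \<subseteq> {1..n}"
    and complete: "\<And>i j. i \<noteq> j \<Longrightarrow> same_component E i j \<Longrightarrow> {i, j} \<in> complete_along W E"
  shows "completion_set n E W"
proof -
  define c where "c = (\<lambda>i. {j \<in> {1..n}. component E i = component E j})"
  have G: "simple_graph n (complete_along W E)"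
    "\<And>i j. {i, j} \<in> complete_along W E \<Longrightarrow> same_component E i j"
    unfolding complete_along_def using fold_complete_at[OF E] by blast+
  have "partition_on {1..n} (c ` {1..n})"
  proof (rule partition_onI)
    show "disjnt p q" if "p \<in> c ` {1..n}" "q \<in> c ` {1..n}" "p \<noteq> q" for p q
      using that by (auto simp: c_def disjnt_def)
  qed (auto simp: c_def)
  moreover have "complete_along W E = (\<Union>B\<in>c ` {1..n}. {e. e \<subseteq> B \<and> card e = 2})"
  proof (intro subset_antisym subsetI)
    fix e assume e: "e \<in> complete_along W E"
    then have e2: "e \<subseteq> {1..n}" "card e = 2" using G(1) by (auto simp: simple_graph_def)
    then obtain i j where "e = {i, j}" by (auto simp: card_2_iff)
    with e2 have ij: "e = {i, j}" "i \<in> {1..n}" "j \<in> {1..n}" "card e = 2" by auto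
    then have "e \<subseteq> c i" using e G(2)[of i j] by (auto simp: c_def component_eq_iff same_component_refl)
    then show "e \<in> (\<Union>B\<in>c ` {1..n}. {e. e \<subseteq> B \<and> card e = 2})" using ij by auto
  next
    fix e assume "e \<in> (\<Union>B\<in>c ` {1..n}. {e. e \<subseteq> B \<and> card e = 2})"
    then obtain k where k: "e \<subseteq> c k" "card e = 2" by auto
    then obtain i j where ij: "e = {i, j}" "i \<noteq> j" by (auto simp: card_2_iff)
    then have "same_component E i j"
      using k by (simp add: c_def flip: component_eq_iff)
    then show "e \<in> complete_along W E" using complete ij by simp
  qed
  ultimately show ?thesis
    using W unfolding completion_set_def disjoint_union_of_complete_def by blast
qed

lemma completion_setD:
  assumes E: "simple_graph n E" and W: "completion_set n E W"
    and i: "i \<in> {1..n}" and ij: "same_component E i j" "i \<noteq> j"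
  shows "{i, j} \<in> complete_along W E"
proof -
  obtain \<P> where part: "partition_on {1..n} \<P>"
    and eq: "complete_along W E = (\<Union>B\<in>\<P>. {e. e \<subseteq> B \<and> card e = 2})"
    using W unfolding completion_set_def disjoint_union_of_complete_def by blast
  have "i \<in> \<Union>\<P>" using part i by (simp add: partition_on_def)
  then obtain B where B: "B \<in> \<P>" "i \<in> B" by blast
  have sub: "E \<subseteq> complete_along W E"
    unfolding complete_along_def by (rule fold_complete_at[OF E])
  have "j \<in> B"
    using ij(1) unfolding same_component_def
  proof induction
    case (step y z)
    then have "{y, z} \<in> complete_along W E" using sub by blast
    then obtain B' where B': "B' \<in> \<P>" "{y, z} \<subseteq> B'" unfolding eq by blast
    then have "B' \<inter> B \<noteq> {}" using step.IH by blast
    then have "B' = B"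
      using disjointD[OF partition_onD2[OF part] B'(1) B(1)] by blast
    with B' show ?case by simp
  qed (rule B)
  with B ij eq show ?thesis by auto
qed

text \<open>A path that passes through \<open>v\<close> can skip it after completing at \<open>v\<close>, since the vertices before and after
  \<open>v\<close> are then equal or adjacent.\<close>

lemma same_component_complete_at:
  assumes "same_component {e \<in> E. e \<subseteq> insert v S} i j" "i \<in> S" "j \<in> S"
  shows "same_component {e \<in> complete_at v E. e \<subseteq> S} i j"
proof (cases "v \<in> S")
  case True
  then show ?thesis
    using assms(1) by (auto intro: same_component_mono[rotated] simp: complete_at_def insert_absorb)
next
  case False
  let ?C = "same_component {e \<in> complete_at v E. e \<subseteq> S}"
  \<comment> \<open>A path that stands at \<open>v\<close> is remembered by the last vertex \<open>u\<close> of \<open>S\<close> before it.\<close>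
  have "(j \<in> S \<longrightarrow> ?C i j) \<and> (j = v \<longrightarrow> (\<exists>u\<in>S. ?C i u \<and> {u, v} \<in> E))"
    using assms(1) unfolding same_component_def[of "{e \<in> E. e \<subseteq> insert v S}"]
  proof induction
    case base
    then show ?case using False assms(2) by (auto intro: same_component_refl)
  next
    case (step y z)
    then have yz: "{y, z} \<in> E" "y \<in> insert v S" "z \<in> insert v S" by auto
    show ?case
    proof (cases "y = v")
      case True
      then obtain u where u: "u \<in> S" "?C i u" "{u, v} \<in> E" using step.IH by blast
      have "?C u z" if "z \<in> S"
      proof (cases "u = z")
        case False
        then have "{u, z} \<in> complete_at v E"
          using u(3) yz True by (auto simp: complete_at_def neighbours_def insert_commute)
        then show ?thesis using u that by (intro same_component_edge) auto
      qed (simp add: same_component_refl)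
      then show ?thesis using u same_component_trans by blast
    next
      case y: False
      then have "y \<in> S" "?C i y" using yz step.IH by auto
      moreover have "?C y z" if "z \<in> S"
        using yz \<open>y \<in> S\<close> that by (intro same_component_edge) (auto simp: complete_at_def)
      ultimately show ?thesis using yz False same_component_trans by blast
    qed
  qed
  with assms(3) show ?thesis by blast
qed

text \<open>If a path joins \<open>i\<close> to \<open>j\<close> with all inner vertices among those completed at, eliminating these vertices
  one after the other leaves the edge \<open>{i, j}\<close>.\<close>

lemma edge_fold_complete_at:
  assumes "same_component {e \<in> E. e \<subseteq> set vs \<union> {i, j}} i j" "i \<noteq> j"
  shows "{i, j} \<in> fold complete_at vs E"
  using assms(1)
proof (induction vs arbitrary: E)
  case Nil
  have "j = i \<or> {i, j} \<in> E"
    using Nil unfolding same_component_def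
  proof induction
    case (step y z)
    then show ?case by (auto simp: insert_commute)
  qed simp
  then show ?case using assms(2) by simp
next
  case (Cons v vs)
  then have "same_component {e \<in> complete_at v E. e \<subseteq> set vs \<union> {i, j}} i j"
    by (intro same_component_complete_at) (auto simp: insert_commute)
  from Cons.IH[OF this] show ?case by simp
qed

lemma completion_set_if_connected_through:
  assumes E: "simple_graph n E" and W: "W \<subseteq> {1..n}"
    and "\<And>i j. i \<noteq> j \<Longrightarrow> same_component E i j \<Longrightarrow> same_component {e \<in> E. e \<subseteq> W \<union> {i, j}} i j"
  shows "completion_set n E W"
proof (rule completion_setI[OF E W])
  have "finite W" using W finite_subset by blast
  then show "{i, j} \<in> complete_along W E" if "i \<noteq> j" "same_component E i j" for i j
    unfolding complete_along_def using assms(3)[OF that] that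
    by (intro edge_fold_complete_at) auto
qed

lemma completion_set_all_vertices:
  assumes E: "simple_graph n E" shows "completion_set n E {1..n}"
proof (rule completion_set_if_connected_through[OF E])
  show "same_component {e \<in> E. e \<subseteq> {1..n} \<union> {i, j}} i j" if "same_component E i j" for i j
    using E by (intro same_component_mono[OF _ that]) (auto simp: simple_graph_def)
qed simp

lemma finite_minimal_completion_sets: "finite {card W |W. minimal_completion_set n E W}"
proof -
  have "{W. minimal_completion_set n E W} \<subseteq> Pow {1..n}"
    by (auto simp: minimal_completion_set_def completion_set_def)
  then have "finite {W. minimal_completion_set n E W}" by (rule finite_subset) simp
  then show ?thesis by (simp add: setcompr_eq_image)
qed

lemma min_comp_le:
  assumes "completion_set n E W" shows "min_comp n E \<le> card W"
proof -
  have "\<exists>V\<subseteq>W. minimal_completion_set n E V" using assms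
  proof (induction "card W" arbitrary: W rule: less_induct)
    case less
    show ?case
    proof (cases "minimal_completion_set n E W")
      case False
      then obtain U where U: "U \<subset> W" "completion_set n E U"
        using less.prems by (auto simp: minimal_completion_set_def)
      have "finite W" using less.prems by (auto simp: completion_set_def intro: finite_subset)
      then have "card U < card W" using U by (intro psubset_card_mono)
      from less.hyps[OF this U(2)] show ?thesis using U(1) by blast
    qed auto
  qed
  then obtain V where V: "V \<subseteq> W" "minimal_completion_set n E V" by blast
  have "finite W" using assms by (auto simp: completion_set_def intro: finite_subset)
  have "min_comp n E \<le> card V"
    unfolding min_comp_def using V finite_minimal_completion_sets by (intro Min_le) auto
  also have "\<dots> \<le> card W" using V \<open>finite W\<close> by (intro card_mono)
  finally show ?thesis .
qed

text \<open>A completion set of least cardinality is in particular a minimal one, so the minimum that defines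
  \<open>min_comp\<close> is over a nonempty set.\<close>

lemma min_comp_attained:
  assumes E: "simple_graph n E"
  obtains W where "completion_set n E W" "card W = min_comp n E"
proof -
  obtain W where W: "completion_set n E W" "\<And>V. completion_set n E V \<Longrightarrow> card W \<le> card V"
    using ex_has_least_nat[of "completion_set n E" _ card] completion_set_all_vertices[OF E] by blast
  have "finite W" using W(1) by (auto simp: completion_set_def intro: finite_subset)
  then have "\<not> completion_set n E U" if "U \<subset> W" for U
    using W(2)[of U] psubset_card_mono[OF _ that] by auto
  then have "minimal_completion_set n E W"
    using W(1) by (simp add: minimal_completion_set_def)
  then have "min_comp n E \<in> {card W |W. minimal_completion_set n E W}"
    unfolding min_comp_def using finite_minimal_completion_sets by (intro Min_in) auto
  then show thesis using that by (auto simp: minimal_completion_set_def)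
qed


section \<open>The product of variables over a completion set\<close>

text \<open>For two neighbours \<open>i, j\<close> of \<open>v\<close>, this is the identity \<open>x\<^sub>v f\<^sub>i\<^sub>j = x\<^sub>i f\<^sub>v\<^sub>j - x\<^sub>j f\<^sub>v\<^sub>i\<close>.\<close>

lemma colon_contains_completed_edge:
  fixes I :: "'k::field mpoly set"
  assumes E: "simple_graph n E" and I: "ideal I (poly_ring n)"
    and gen: "\<And>i j. {i, j} \<in> E \<Longrightarrow> edge_binomial i j \<in> I"
    and v: "v \<in> {1..n}" and e: "{i, j} \<in> complete_at v E"
  shows "edge_binomial i j \<in> colon (poly_ring n) I (indet_poly (X v))"
proof -
  have "{i, j} \<subseteq> {1..n}"
    using simple_graph_complete_at[OF E, of v] e unfolding simple_graph_def by blast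
  then have ij: "i \<in> {1..n}" "j \<in> {1..n}" by auto
  have "edge_binomial i j * indet_poly (X v) \<in> I"
  proof (cases "{i, j} \<in> E")
    case True
    then show ?thesis
      using ideal_mult[OF I gen indet_poly_closed(1)[OF v]] by (simp add: mult.commute)
  next
    case False
    then have "edge_binomial v j \<in> I" "edge_binomial v i \<in> I"
      using e by (auto simp: complete_at_def neighbours_def doubleton_eq_iff intro!: gen)
    then have "indet_poly (X i) * edge_binomial v j - indet_poly (X j) * edge_binomial v i \<in> I"
      using I ij by (intro ideal_diff ideal_mult indet_poly_closed)
    also have "indet_poly (X i) * edge_binomial v j - indet_poly (X j) * edge_binomial v i
        = (edge_binomial i j * indet_poly (X v) :: 'k mpoly)"
      by (simp add: edge_binomial_def algebra_simps)
    finally show ?thesis .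
  qed
  then show ?thesis using ij by (simp add: colon_def edge_binomial_closed)
qed

definition vertex_product :: "nat list \<Rightarrow> 'k::field mpoly" where
  "vertex_product vs = (\<Prod>v\<leftarrow>vs. indet_poly (X v))"

text \<open>The induction replaces \<open>I\<close> by \<open>(I : x\<^sub>v)\<close>, which contains the binomials of the graph completed at \<open>v\<close>;
  this is why the ideal is arbitrary and not a binomial edge ideal.\<close>

lemma vertex_product_mult_edge:
  fixes I :: "'k::field mpoly set"
  assumes "simple_graph n E" "ideal I (poly_ring n)"
    and "\<And>i j. {i, j} \<in> E \<Longrightarrow> edge_binomial i j \<in> I"
    and "set vs \<subseteq> {1..n}" "{i, j} \<in> fold complete_at vs E"
  shows "edge_binomial i j * vertex_product vs \<in> I"
  using assms
proof (induction vs arbitrary: E I)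
  case (Cons v vs)
  have v: "v \<in> {1..n}" using Cons.prems by simp
  let ?I = "colon (poly_ring n) I (indet_poly (X v))"
  have "edge_binomial i j * vertex_product vs \<in> ?I"
    using Cons.prems v
    by (intro Cons.IH[of "complete_at v E"] simple_graph_complete_at ideal_colon indet_poly_closed
        colon_contains_completed_edge[OF Cons.prems(1,2,3)]) auto
  then show ?case by (simp add: colon_def vertex_product_def algebra_simps)
qed (simp add: vertex_product_def)

lemma monom_degree_superset:
  assumes "finite A" "keys m \<subseteq> A" shows "monom_degree m = (\<Sum>z\<in>A. lookup m z)"
  unfolding monom_degree_def
  by (rule sum.mono_neutral_left) (use assms in \<open>auto simp: in_keys_iff\<close>)

lemma monom_degree_add: "monom_degree (a + b) = monom_degree a + monom_degree b"
  by (simp add: monom_degree_superset[of "keys a \<union> keys b"] keys_plus_nat lookup_add sum.distrib)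

lemma vertex_product_monomial:
  obtains m where "vertex_product vs = (single m 1 :: 'k::field mpoly)" "m \<in> monomials_on (set vs)"
    "monom_degree m = length vs"
proof -
  have "\<exists>m. vertex_product vs = (single m 1 :: 'k mpoly) \<and> m \<in> monomials_on (set vs) \<and>
      monom_degree m = length vs"
  proof (induction vs)
    case Nil
    show ?case
      by (rule exI[of _ 0]) (auto simp: vertex_product_def zero_in_monomials_on monom_degree_def)
  next
    case (Cons v vs)
    then obtain m where m: "vertex_product vs = (single m 1 :: 'k mpoly)"
      "m \<in> monomials_on (set vs)" "monom_degree m = length vs" by blast
    have "vertex_product (v # vs) = (single (single (X v) 1 + m) 1 :: 'k mpoly)"
      using m(1) by (simp add: vertex_product_def indet_poly_def mult_single)
    moreover have "single (X v) 1 + m \<in> monomials_on (set (v # vs))"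
      using m(2) monomials_on_mono[of "set vs" "set (v # vs)"]
      by (auto simp: plus_in_monomials_on single_in_monomials_on)
    moreover have "monom_degree (single (X v) 1 + m) = length (v # vs)"
      using m(3) by (simp add: monom_degree_add) (simp add: monom_degree_def)
    ultimately show ?case by blast
  qed
  then show thesis using that by blast
qed

lemma vertex_product_homogeneous_nonzero:
  assumes "set vs \<subseteq> {1..n}"
  shows "(vertex_product vs :: 'k::field mpoly) \<in> homogeneous_part n (length vs)"
    and "weight_image E {1..n} (vertex_product vs :: 'k mpoly) \<noteq> 0"
proof -
  obtain m where m: "vertex_product vs = (single m 1 :: 'k mpoly)" "m \<in> monomials_on (set vs)"
    "monom_degree m = length vs" by (rule vertex_product_monomial)
  have "m \<in> monomials_on {1..n}" using m(2) monomials_on_mono[OF assms] by blast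
  then show "weight_image E {1..n} (vertex_product vs :: 'k mpoly) \<noteq> 0"
    by (simp add: m(1) weight_image_single) (metis lookup_single_eq lookup_zero one_neq_zero)
  show "(vertex_product vs :: 'k mpoly) \<in> homogeneous_part n (length vs)"
    using m(1,3) \<open>m \<in> monomials_on {1..n}\<close> by (simp add: homogeneous_part_def single_closed del: One_nat_def)
qed

lemma P_empty_mult_vertex_product:
  fixes g :: "'k::field mpoly"
  assumes E: "simple_graph n E" and W: "completion_set n E W" and g: "g \<in> P_empty n E"
  shows "g * vertex_product (sorted_list_of_set W) \<in> binomial_edge_ideal n E"
proof -
  let ?x = "vertex_product (sorted_list_of_set W) :: 'k mpoly"
  have "W \<subseteq> {1..n}" using W by (simp add: completion_set_def)
  then have W': "set (sorted_list_of_set W) \<subseteq> {1..n}"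
    using finite_subset[of W "{1..n}"] by simp
  have x: "?x \<in> carrier (poly_ring n)"
    using vertex_product_homogeneous_nonzero(1)[OF W'] by (auto simp: homogeneous_part_def)
  have "P_empty n E \<subseteq> colon (poly_ring n) (binomial_edge_ideal n E) ?x"
  proof (rule P_empty_generated(3)[OF ideal_colon[OF binomial_edge_ideal_generated(1)[OF E] x]])
    fix i j assume ij: "i \<in> {1..n}" "j \<in> {1..n}" "same_component E i j"
    have "edge_binomial i j * ?x \<in> binomial_edge_ideal n E"
    proof (cases "i = j")
      case True
      then show ?thesis using ideal_zero[OF binomial_edge_ideal_generated(1)[OF E]] by simp
    next
      case False
      then have "{i, j} \<in> fold complete_at (sorted_list_of_set W) E"
        using completion_setD[OF E W ij(1,3)] by (simp add: complete_along_def)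
      then show ?thesis
        by (intro vertex_product_mult_edge[OF E] binomial_edge_ideal_generated[OF E] W')
    qed
    then show "edge_binomial i j \<in> colon (poly_ring n) (binomial_edge_ideal n E) ?x"
      using ij by (simp add: colon_def edge_binomial_closed)
  qed
  with g show ?thesis by (auto simp: colon_def)
qed

text \<open>The inclusion from left to right holds because \<open>J\<close> lies in the prime ideal \<open>P\<close>, which does not contain the
  monomial.\<close>

lemma colon_vertex_product:
  assumes E: "simple_graph n E" and W: "completion_set n E W"
  shows "colon (poly_ring n) (binomial_edge_ideal n E) (vertex_product (sorted_list_of_set W))
    = (P_empty n E :: 'k::field mpoly set)"
proof -
  let ?x = "vertex_product (sorted_list_of_set W) :: 'k mpoly"
  have "W \<subseteq> {1..n}" using W by (simp add: completion_set_def)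
  then have W': "set (sorted_list_of_set W) \<subseteq> {1..n}"
    using finite_subset[of W "{1..n}"] by simp
  have "g \<in> P_empty n E"
    if g: "g \<in> carrier (poly_ring n)" "g * ?x \<in> binomial_edge_ideal n E" for g
  proof -
    have "g * ?x \<in> P_empty n E"
      using binomial_edge_ideal_subset_P_empty[OF E] g(2) by blast
    then have "weight_image E {1..n} g * weight_image E {1..n} ?x = 0"
      unfolding P_empty_eq_kernel by (simp only: mem_Collect_eq weight_image_mult)
    with vertex_product_homogeneous_nonzero(2)[OF W'] have "weight_image E {1..n} g = 0"
      by (metis mult_eq_0_iff)
    with g(1) show ?thesis unfolding P_empty_eq_kernel by blast
  qed
  moreover have "P_empty n E \<subseteq> carrier (poly_ring n)"
    by (auto simp: P_empty_eq_kernel)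
  ultimately show ?thesis
    using P_empty_mult_vertex_product[OF E W] by (auto simp: colon_def)
qed


section \<open>A completion set from an element with colon ideal $P$\<close>

text \<open>Setting the variables outside \<open>U\<close> to \<open>0\<close> turns \<open>p\<close> into an element of the kernel for \<open>F\<close>, that is, of
  \<open>P_empty n F\<close>, whose generators are among those of \<open>P_empty n E\<close>.\<close>

lemma kernel_mono:
  assumes U: "U \<subseteq> {1..n}" and F: "F \<subseteq> E" and p: "weight_image F U p = 0"
  shows "weight_image E U p = 0"
proof -
  define q where "q = pushforward id (monomials_on U) p"
  have q: "weight_image H {1..n} q = weight_image H U p" for H
  proof -
    have "monomials_on U \<inter> id -` monomials_on {1..n} = monomials_on U"
      using monomials_on_mono[OF U] by auto
    then show ?thesis
      by (simp add: q_def weight_image_def pushforward_pushforward)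
  qed
  have "keys q \<subseteq> monomials_on U"
  proof
    fix m assume "m \<in> keys q"
    then have "(\<Sum>a | a \<in> keys p \<inter> monomials_on U \<and> id a = m. lookup p a) \<noteq> 0"
      unfolding q_def in_keys_iff lookup_pushforward .
    then have "{a. a \<in> keys p \<inter> monomials_on U \<and> id a = m} \<noteq> {}"
      by (rule contrapos_nn) (simp only: sum.empty)
    then show "m \<in> monomials_on U" by auto
  qed
  then have "q \<in> P_empty n F"
    using monomials_on_mono[OF U] p q by (auto simp: P_empty_eq_kernel carrier_poly_ring)
  moreover have "P_empty n F \<subseteq> P_empty n E"
    using same_component_mono[OF F] by (intro P_empty_generated(3) P_empty_generated(1,2))
  ultimately have "weight_image E {1..n} q = 0" by (auto simp: P_empty_eq_kernel)
  then show ?thesis by (simp only: q)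
qed

lemma same_component_vertices:
  assumes E: "simple_graph n E" and ij: "same_component E i j" "i \<noteq> j"
  shows "i \<in> {1..n}" "j \<in> {1..n}"
proof -
  have "b \<in> {1..n}" if "same_component E a b" "a \<noteq> b" for a b
    using that(1)[unfolded same_component_def] that(2)
    by (cases rule: rtranclE) (use E in \<open>auto simp: simple_graph_def\<close>)
  then show "i \<in> {1..n}" "j \<in> {1..n}" using ij same_component_sym by metis+
qed

text \<open>The completion set consists of the vertices whose variables occur in a suitable multihomogeneous
  component of \<open>f\<close>; multihomogeneity is what makes its cardinality at most \<open>d\<close> and what lets the component
  survive when the variables of other vertices are set to \<open>0\<close>.\<close>

lemma completion_set_from_colon:
  fixes f :: "'k::field mpoly"
  assumes E: "simple_graph n E" and f: "f \<in> homogeneous_part n d" "f \<notin> P_empty n E"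
    and colon: "\<And>g. g \<in> P_empty n E \<Longrightarrow> g * f \<in> binomial_edge_ideal n E"
  obtains W where "completion_set n E W" "card W \<le> d"
proof -
  have "weight_image E {1..n} f \<noteq> 0"
    using f by (auto simp: P_empty_eq_kernel homogeneous_part_def)
  then obtain t where t: "lookup (weight_image E {1..n} f) t \<noteq> 0"
    by (auto simp: poly_mapping_eq_iff fun_eq_iff)
  define C where "C = {m. m \<in> keys f \<inter> monomials_on {1..n} \<and> weight E m = t}"
  have C: "(\<Sum>m\<in>C. lookup f m) \<noteq> 0"
    using t by (simp only: weight_image_def lookup_pushforward C_def not_False_eq_True)
  then obtain m where m: "m \<in> C" by fastforce
  define W where "W = {i. lookup t (2 * i) \<noteq> 0}"
  have C_on: "a \<in> monomials_on W" if "a \<in> C" for a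
    unfolding monomials_on_def
  proof safe
    fix z assume z: "z \<in> keys a" "z \<notin> Y ` W"
    have deg: "lookup t (2 * i) = lookup a (X i) + lookup a (Y i)" for i
      using that lookup_weight_even[of E a i] by (simp add: C_def)
    from z show "z \<in> X ` W"
      by (cases z) (auto simp: W_def deg in_keys_iff)
  qed
  have degm: "lookup t (2 * i) = lookup m (X i) + lookup m (Y i)" for i
    using m lookup_weight_even[of E m i] by (simp add: C_def)
  have keys_m: "keys m \<subseteq> indets n"
    using m by (auto simp: C_def monomials_on_def indets_def)
  have Wn: "W \<subseteq> {1..n}"
  proof
    fix i assume "i \<in> W"
    then have "X i \<in> keys m \<or> Y i \<in> keys m" by (auto simp: W_def degm in_keys_iff)
    then show "i \<in> {1..n}" using keys_m by (auto simp: indets_def)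
  qed
  have card: "card W \<le> d"
  proof -
    have "card W = (\<Sum>i\<in>W. 1)" by simp
    also have "\<dots> \<le> (\<Sum>i\<in>W. lookup t (2 * i))" by (intro sum_mono) (auto simp: W_def)
    also have "\<dots> \<le> (\<Sum>i\<in>{1..n}. lookup t (2 * i))" using Wn by (intro sum_mono2) auto
    also have "\<dots> = (\<Sum>i\<in>{1..n}. lookup m (X i)) + (\<Sum>i\<in>{1..n}. lookup m (Y i))"
      by (simp add: degm sum.distrib)
    also have "\<dots> = (\<Sum>z\<in>indets n. lookup m z)"
      unfolding indets_def by (subst sum.union_disjoint) (auto simp: sum.reindex inj_on_def)
    also have "\<dots> = monom_degree m"
      using keys_m by (intro monom_degree_superset[symmetric]) (auto simp: indets_def)
    also have "\<dots> = d" using m f(1) by (auto simp: C_def homogeneous_part_def)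
    finally show ?thesis .
  qed
  have "completion_set n E W"
  proof (rule completion_set_if_connected_through[OF E Wn], rule ccontr)
    fix i j assume ij: "i \<noteq> j" "same_component E i j"
    define U where "U = W \<union> {i, j}"
    define F where "F = {e \<in> E. e \<subseteq> U}"
    assume "\<not> same_component {e \<in> E. e \<subseteq> W \<union> {i, j}} i j"
    then have sep: "\<not> same_component F i j" by (simp add: F_def U_def)
    have ijn: "i \<in> {1..n}" "j \<in> {1..n}" using same_component_vertices[OF E ij(2,1)] .
    then have U: "U \<subseteq> {1..n}" using Wn by (simp add: U_def)
    have "edge_binomial i j * f \<in> binomial_edge_ideal n E"
      using ijn ij(2) by (intro colon P_empty_generated(2))
    then have "weight_image F U (edge_binomial i j * f) = 0"
      by (rule binomial_edge_ideal_weight_image[OF E, rotated])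
        (auto simp: F_def intro: same_component_edge)
    then have "weight_image F U f = 0"
      using sep weight_image_edge_binomial[of F U i j, where 'k = 'k]
      by (auto simp: weight_image_mult U_def)
    then have "weight_image E U f = 0"
      by (rule kernel_mono[OF U, rotated]) (auto simp: F_def)
    moreover have "{m. m \<in> keys f \<inter> monomials_on U \<and> weight E m = t} = C"
    proof -
      have "monomials_on W \<subseteq> monomials_on U" "monomials_on U \<subseteq> monomials_on {1..n}"
        using U by (auto simp: U_def intro!: monomials_on_mono)
      then show ?thesis using C_on unfolding C_def by blast
    qed
    moreover have "lookup (weight_image E U f) t
        = (\<Sum>m | m \<in> keys f \<inter> monomials_on U \<and> weight E m = t. lookup f m)"
      by (simp only: weight_image_def lookup_pushforward)
    ultimately show False using C by simp
  qed
  with card that show thesis by blast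
qed

text \<open>The product \<open>x\<close> of all \<open>x\<^sub>v\<close> carries \<open>P\<close> into \<open>J\<close>. If \<open>f\<close> were in \<open>P\<close>, then \<open>x\<close> would lie in
  \<open>(J : f) = P\<close>, but no monomial lies in \<open>P\<close>.\<close>

lemma colon_eq_P_empty_imp_notin:
  fixes f :: "'k::field mpoly"
  assumes E: "simple_graph n E"
    and f: "colon (poly_ring n) (binomial_edge_ideal n E) f = P_empty n E"
  shows "f \<notin> P_empty n E"
proof
  assume "f \<in> P_empty n E"
  let ?vs = "sorted_list_of_set {1..n}"
  let ?x = "vertex_product ?vs :: 'k mpoly"
  have "f * ?x \<in> binomial_edge_ideal n E"
    using P_empty_mult_vertex_product[OF E completion_set_all_vertices[OF E] \<open>f \<in> _\<close>] .
  moreover have "?x \<in> carrier (poly_ring n)"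
    using vertex_product_homogeneous_nonzero(1)[of ?vs n] by (auto simp: homogeneous_part_def)
  ultimately have "?x \<in> P_empty n E"
    unfolding f[symmetric] by (simp add: colon_def mult.commute)
  then show False
    using vertex_product_homogeneous_nonzero(2)[of ?vs n E, where 'k = 'k] by (simp add: P_empty_eq_kernel)
qed

theorem theorem3p6:
  fixes n :: nat and E :: "nat set set"
  assumes "simple_graph n E"
  shows "v_empty TYPE('k::field) n E = enat (min_comp n E)
       \<and> v_binomial_edge_ideal TYPE('k) n E \<le> enat (min_comp n E)"
proof -
  note E = assms
  let ?J = "binomial_edge_ideal n E :: 'k mpoly set" and ?P = "P_empty n E :: 'k mpoly set"
  obtain W where W: "completion_set n E W" "card W = min_comp n E"
    by (rule min_comp_attained[OF E])
  let ?f = "vertex_product (sorted_list_of_set W) :: 'k mpoly"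
  have "W \<subseteq> {1..n}" using W by (simp add: completion_set_def)
  then have "finite W" by (rule finite_subset) simp
  then have f: "?f \<in> homogeneous_part n (min_comp n E)"
    using vertex_product_homogeneous_nonzero(1)[of "sorted_list_of_set W" n] \<open>W \<subseteq> _\<close> W(2) by simp
  have colon_f: "colon (poly_ring n) ?J ?f = ?P"
    by (rule colon_vertex_product[OF E W(1)])
  have eq: "v_empty TYPE('k) n E = enat (min_comp n E)"
    unfolding v_empty_def v_number_at_def
  proof (rule antisym)
    show "Inf {enat d |d. \<exists>f\<in>homogeneous_part n d. colon (poly_ring n) ?J f = ?P} \<le> enat (min_comp n E)"
      using f colon_f by (intro Inf_lower) blast
    show "enat (min_comp n E) \<le> Inf {enat d |d. \<exists>f\<in>homogeneous_part n d. colon (poly_ring n) ?J f = ?P}"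
    proof (rule Inf_greatest)
      fix e assume "e \<in> {enat d |d. \<exists>f\<in>homogeneous_part n d. colon (poly_ring n) ?J f = ?P}"
      then obtain d g where d: "e = enat d" "g \<in> homogeneous_part n d" "colon (poly_ring n) ?J g = ?P"
        by blast
      have "h * g \<in> ?J" if "h \<in> ?P" for h
        using that unfolding d(3)[symmetric] by (simp add: colon_def)
      then obtain V where "completion_set n E V" "card V \<le> d"
        using completion_set_from_colon[OF E d(2) colon_eq_P_empty_imp_notin[OF E d(3)]] by blast
      then show "enat (min_comp n E) \<le> e"
        using min_comp_le le_trans d(1) by fastforce
    qed
  qed
  have "?P \<in> associated_primes (poly_ring n) ?J"
    using primeideal_P_empty f colon_f by (auto simp: associated_primes_def homogeneous_part_def)
  then have "v_binomial_edge_ideal TYPE('k) n E \<le> v_empty TYPE('k) n E"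
    unfolding v_binomial_edge_ideal_def v_number_def v_empty_def by (rule INF_lower)
  with eq show ?thesis by simp
qed

end
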